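(* Under the random selection rule with static probabilities, for every seller $n\in\{1,\dots,N\}$ the value function $v_n(t,d_n,\mathbf{s})$ satisfies the following, for all times $t$, remaining inventories $d_n$ and sales histories $\mathbf{s}$ for which all the terms appearing are defined: (1) (Monotone in inventory) $\mathbb{E}_{n,t-1}[v_n(t,d_n,\mathbf{s})]\ge \mathbb{E}_{n,t-1}[v_n(t,d_n-1,\mathbf{s})]$. (2) (Monotone in the selling amount of competitors) for every $i\ne n$, $\mathbb{E}_{n,t-1}[v_n(t,d_n,\mathbf{s})]\le \mathbb{E}_{n,t-1}[v_n(t,d_n,\mathbf{s}+\mathbf{e}_i)]$. (3) (Monotone in time) $\mathbb{E}_{n,t-1}[v_n(t,d_n,\mathbf{s})]\ge \mathbb{E}_{n,t}[v_n(t+1,d_n,\mathbf{s})]$. (4) ("Concave" in $d_n$) $$\mathbb{E}_{n,t-1}[v_n(t,d_n,\mathbf{s})-v_n(t,d_n-1,\mathbf{s}+\mathbf{e}_n)]\ \ge\ \mathbb{E}_{n,t-1}[v_n(t,d_n+1,\mathbf{s})-v_n(t,d_n,\mathbf{s}+\mathbf{e}_n)].$$ (5) (Submodular in time and inventory) $$\mathbb{E}_{n,t-1}[v_n(t,d_n,\mathbf{s})]-\mathbb{E}_{n,t-1}[v_n(t,d_n-1,\mathbf{s}+\mathbf{e}_n)]\ \ge\ \mathbb{E}_{n,t}[v_n(t+1,d_n,\mathbf{s})]-\mathbb{E}_{n,t}[v_n(t+1,d_n-1,\mathbf{s}+\mathbf{e}_n)].$$ (6) (Submodular in inventories) for every $m\ne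 n$, $$\mathbb{E}_{n,t-1}[v_n(t,d_n,\mathbf{s})]-\mathbb{E}_{n,t-1}[v_n(t,d_n-1,\mathbf{s}+\mathbf{e}_n)]\ \ge\ \mathbb{E}_{n,t-1}[v_n(t,d_n,\mathbf{s}-\mathbf{e}_m)]-\mathbb{E}_{n,t-1}[v_n(t,d_n-1,\mathbf{s}+\mathbf{e}_n-\mathbf{e}_m)].$$
   Context: Model. There are $N$ sellers; seller $n$ has initial inventory $C_n$ (a nonnegative integer number of units) of a product. The selling horizon is $t=1,\dots,T$. In each period one unit of demand arrives, with an offered price $P$; prices are i.i.d. over periods with $\Pr[P=p_i]=\theta_i$, $i=1,\dots,I$, the $p_i$ being nonnegative. Each seller with positive remaining inventory accepts or rejects the demand. Selection rule (random selection with static probabilities): fixed probabilities $\pi_1,\dots,\pi_N\ge 0$ with $\sum_{n=1}^N\pi_n=1$ are given; if $A$ is the set of sellers that accept, each $n\in A$ is selected with probability $\pi_n$, and no one is selected with probability $1-\sum_{n\in A}\pi_n$. The selected seller collects the price and loses one unit of inventory. Inventory left after time $T$ has value $0$. Information. $\mathbf{s}=(s_1,\dots,s_N)$ is the vector of units sold so far by each seller (observed by all), $\mathbf{e}_n$ is the $n$-th unit vector, and $d_n=C_n-s_n$ is the remaining inventory of seller $n$, known only to seller $n$. Sellers do not know the competitors' initial inventories but share a common distributional estimate of each $C_m$: any two sellers have the same distribution for a third seller's inventory. $\mathbb{E}_{n,t}$ denotes expectation with respect to the information available to seller $n$ at time $t$, i.e. with each competitor's $C_m$ distributed according to its estimated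 distribution conditioned on $C_m\ge s_m$ (so the belief is updated only through the cumulative sales). Value functions. $v_n(t,d_n,\mathbf{s})$ is the maximum expected revenue seller $n$ can collect from time $t$ on, with remaining inventory $d_n$ and sales history $\mathbf{s}$, when in each period all sellers follow the strategy of accepting price $p$ exactly when $p\ge \mathbb{E}_{n,t}[v_n(t+1,d_n,\mathbf{s})-v_n(t+1,d_n-1,\mathbf{s}+\mathbf{e}_n)]$ (and inventory is positive). It is determined backward by $v_n(T,d_n,\mathbf{s})=\pi_n\mathbb{E}[P]$ for $d_n\ge 1$, $v_n(t,0,\mathbf{s})=0$, and, for $t<T$ and $d_n\ge 1$, $$v_n(t,d_n,\mathbf{s})=\sum_{i=1}^I\theta_i\,w_n(t+1,d_n,\mathbf{s},p_i),$$ where, with $a_m(p)=\mathbf{1}\{d_m\ge 1 \text{ and } p\ge \mathbb{E}_{m,t}[v_m(t+1,d_m,\mathbf{s})-v_m(t+1,d_m-1,\mathbf{s}+\mathbf{e}_m)]\}$ and $d_m=C_m-s_m$, $$w_n(t+1,d_n,\mathbf{s},p)=\Big(1-\sum_{m=1}^N\pi_m\Big)\mathbb{E}_{n,t}[v_n(t+1,d_n,\mathbf{s})]+\pi_n\Big(a_n(p)\,\mathbb{E}_{n,t}[p+v_n(t+1,d_n-1,\mathbf{s}+\mathbf{e}_n)]+(1-a_n(p))\,\mathbb{E}_{n,t}[v_n(t+1,d_n,\mathbf{s})]\Big)+\sum_{m\ne n}\pi_m\,\mathbb{E}_{n,t}\big[a_m(p)\,v_n(t+1,d_n,\mathbf{s}+\mathbf{e}_m)+(1-a_m(p))\,v_n(t+1,d_n,\mathbf{s})\big].$$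 *)

theory Defs
  imports "HOL-Probability.Probability"
begin

text \<open>
  Sellers are indexed by a finite type \<open>'n\<close> and price levels by a finite type \<open>'i\<close>. Throughout,
  \<open>s :: 'n \<Rightarrow> nat\<close> is the vector of units sold so far, \<open>d\<close> is the remaining inventory of the seller
  under consideration, and \<open>F m\<close> is the estimate of the initial inventory of seller \<open>m\<close> that is
  shared by all other sellers. The vectors \<open>s + e_m\<close> and \<open>s - e_m\<close> are written as function updates.
\<close>

text \<open>
  The belief of seller \<open>n\<close> depends on time only through the cumulative sales \<open>s\<close>. The integrands
  used below depend on at most one coordinate, so that only the marginals of this product
  distribution matter. Coordinate \<open>n\<close> is a dummy \<open>0\<close>: seller \<open>n\<close> knows the own inventory, which
  is passed separately as \<open>d\<close>. \<open>cond_pmf (F m) {s m..}\<close> is meaningful only if \<open>F m\<close> gives positive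
  probability to \<open>{s m..}\<close>.
\<close>
definition belief :: "('n::finite \<Rightarrow> nat pmf) \<Rightarrow> 'n \<Rightarrow> ('n \<Rightarrow> nat) \<Rightarrow> ('n \<Rightarrow> nat) pmf" where
  "belief F n s = Pi_pmf (UNIV - {n}) 0 (\<lambda>m. cond_pmf (F m) {s m..})"

definition belief_exp ::
  "('n::finite \<Rightarrow> nat pmf) \<Rightarrow> 'n \<Rightarrow> ('n \<Rightarrow> nat) \<Rightarrow> (('n \<Rightarrow> nat) \<Rightarrow> real) \<Rightarrow> real" where
  "belief_exp F n s X = measure_pmf.expectation (belief F n s) X"

text \<open>The estimates conditioned upon by seller \<open>n\<close> at sales history \<open>s\<close> all exist.\<close>
definition belief_defined :: "('n::finite \<Rightarrow> nat pmf) \<Rightarrow> 'n \<Rightarrow> ('n \<Rightarrow> nat) \<Rightarrow> bool" where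
  "belief_defined F n s \<longleftrightarrow> (\<forall>m. m \<noteq> n \<longrightarrow> measure_pmf.prob (F m) {s m..} > 0)"

text \<open>In the next two definitions, \<open>u m d s\<close> stands for the next-period value of seller \<open>m\<close>.\<close>
definition accepts ::
  "('n::finite \<Rightarrow> nat pmf) \<Rightarrow> ('n \<Rightarrow> nat \<Rightarrow> ('n \<Rightarrow> nat) \<Rightarrow> real) \<Rightarrow>
   'n \<Rightarrow> nat \<Rightarrow> ('n \<Rightarrow> nat) \<Rightarrow> real \<Rightarrow> bool" where
  "accepts F u m d s x \<longleftrightarrow>
     d \<ge> 1 \<and> x \<ge> belief_exp F m s (\<lambda>C. u m d s - u m (d - 1) (s(m := s m + 1)))"

definition offer_value ::
  "('n::finite \<Rightarrow> real) \<Rightarrow> ('n \<Rightarrow> nat pmf) \<Rightarrow> ('n \<Rightarrow> nat \<Rightarrow> ('n \<Rightarrow> nat) \<Rightarrow> real) \<Rightarrow>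
   'n \<Rightarrow> nat \<Rightarrow> ('n \<Rightarrow> nat) \<Rightarrow> real \<Rightarrow> real" where
  "offer_value \<pi> F u n d s x =
     (1 - (\<Sum>m\<in>UNIV. \<pi> m)) * belief_exp F n s (\<lambda>C. u n d s)
     + \<pi> n * (of_bool (accepts F u n d s x) *
                 belief_exp F n s (\<lambda>C. x + u n (d - 1) (s(n := s n + 1)))
              + (1 - of_bool (accepts F u n d s x)) * belief_exp F n s (\<lambda>C. u n d s))
     + (\<Sum>m\<in>UNIV - {n}. \<pi> m * belief_exp F n s (\<lambda>C.
          of_bool (accepts F u m (C m - s m) s x) * u n d (s(m := s m + 1))
          + (1 - of_bool (accepts F u m (C m - s m) s x)) * u n d s))"

text \<open>
  The value function is meant for \<open>t \<le> T\<close>; for later times the equation below just repeats the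
  terminal value.
\<close>
function seller_value ::
  "nat \<Rightarrow> ('n::finite \<Rightarrow> real) \<Rightarrow> ('i::finite \<Rightarrow> real) \<Rightarrow> ('i \<Rightarrow> real) \<Rightarrow> ('n \<Rightarrow> nat pmf) \<Rightarrow>
   'n \<Rightarrow> nat \<Rightarrow> nat \<Rightarrow> ('n \<Rightarrow> nat) \<Rightarrow> real" where
  "seller_value T \<pi> \<theta> p F n t d s =
     (if d = 0 then 0
      else if t < T then
        (\<Sum>i\<in>UNIV. \<theta> i *
           offer_value \<pi> F (\<lambda>m d' s'. seller_value T \<pi> \<theta> p F m (t + 1) d' s') n d s (p i))
      else \<pi> n * (\<Sum>i\<in>UNIV. \<theta> i * p i))"
  by auto
termination
  by (relation "Wellfounded.measure (\<lambda>(T, \<pi>, \<theta>, p, F, n, t, d, s). T - t)") auto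

declare seller_value.simps [simp del]

end

theory Submission
  imports Defs
begin

text \<open>
  Under static selection probabilities the demand reaches seller \<open>n\<close> with probability \<open>\<pi> n\<close>,
  whatever the competitors do: a competitor who rejects does not pass the demand on. A sale by
  competitor \<open>m\<close> therefore affects the value of seller \<open>n\<close> only through the argument \<open>s\<close> of the
  next-period value. The terminal value does not mention \<open>s\<close>, so by backward induction no value
  does: the two branches of each competitor's term agree, and the beliefs average a constant
  (lemmas \<open>offer_value_history_free\<close> and \<open>seller_value_eq_solo_revenue\<close>). Monotonicity in
  the sales of competitors and submodularity in inventories thus hold with equality, and the other
  claims concern one seller who faces no competition.

  For that seller let \<open>g k d\<close> be the optimal revenue with \<open>k\<close> periods to go and \<open>d\<close> units, and let
  \<open>D k d = g k (d + 1) - g k d\<close> be the marginal value of a unit. The threshold strategy takes the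
  better of selling and keeping, which gives \<open>g (k + 1) d = g k d + h (D k (d - 1))\<close> for \<open>d \<ge> 1\<close>,
  where \<open>h x\<close> is \<open>\<pi> n\<close> times the expected excess of the price over the opportunity cost \<open>x\<close>.
  Three properties of \<open>h\<close> suffice: it is nonnegative, it is nonincreasing, and \<open>x + h x\<close> is
  nondecreasing, the last because the probability of being selected is at most one.
  Nonnegativity is monotonicity in time. Concavity carries over from \<open>k\<close> to \<open>k + 1\<close> because it
  yields \<open>D (k + 1) (d + 1) \<le> D k d \<le> D (k + 1) d\<close> (lemmas \<open>marginal_step_upper\<close> and
  \<open>marginal_step_lower\<close>). The right-hand inequality is also submodularity in time and inventory,
  and, starting from \<open>D 0 = 0\<close>, it makes marginal values nonnegative.
\<close>

section \<open>A single seller with a general one-period gain\<close>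

text \<open>
  The recursion starts with no period left. This agrees with the terminal value of the model since
  with nonnegative prices the last period earns \<open>h 0\<close>.
\<close>
primrec solo_revenue :: "(real \<Rightarrow> real) \<Rightarrow> nat \<Rightarrow> nat \<Rightarrow> real" where
  "solo_revenue h 0 d = 0"
| "solo_revenue h (Suc k) d =
     (if d = 0 then 0
      else solo_revenue h k d + h (solo_revenue h k d - solo_revenue h k (d - 1)))"

definition marginal :: "(real \<Rightarrow> real) \<Rightarrow> nat \<Rightarrow> nat \<Rightarrow> real" where
  "marginal h k d = solo_revenue h k (Suc d) - solo_revenue h k d"

lemma solo_revenue_no_inventory [simp]: "solo_revenue h k 0 = 0"
  by (cases k) auto

lemma marginal_Suc_0: "marginal h (Suc k) 0 = marginal h k 0 + h (marginal h k 0)"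
  by (simp add: marginal_def)

lemma marginal_Suc_Suc:
  "marginal h (Suc k) (Suc d) =
     marginal h k (Suc d) + h (marginal h k (Suc d)) - h (marginal h k d)"
  by (simp add: marginal_def)

text \<open>
  An extra period raises the marginal value of a unit: the gain from selling now is larger where
  the unit given up is worth less, that is, at the larger inventory.
\<close>
lemma marginal_step_lower:
  assumes "antimono h" and "\<And>x. 0 \<le> h x"
    and "\<And>d. marginal h k (Suc d) \<le> marginal h k d"
  shows "marginal h k d \<le> marginal h (Suc k) d"
proof (cases d)
  case 0
  then show ?thesis using assms(2) by (simp add: marginal_Suc_0)
next
  case (Suc e)
  have "h (marginal h k e) \<le> h (marginal h k (Suc e))"
    using assms(1,3) by (simp add: antimonoD)
  then show ?thesis using Suc by (simp add: marginal_Suc_Suc)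
qed

text \<open>
  An extra period is worth at most one extra unit: the second of two consecutive marginal values
  cannot overtake the earlier value of the first. This is where \<open>x + h x\<close> being nondecreasing
  enters.
\<close>
lemma marginal_step_upper:
  assumes "mono (\<lambda>x. x + h x)" and "\<And>d. marginal h k (Suc d) \<le> marginal h k d"
  shows "marginal h (Suc k) (Suc d) \<le> marginal h k d"
  using monoD[OF assms(1) assms(2)[of d]] by (simp add: marginal_Suc_Suc)

lemma marginal_decreasing:
  assumes "antimono h" and "\<And>x. 0 \<le> h x" and "mono (\<lambda>x. x + h x)"
  shows "marginal h k (Suc d) \<le> marginal h k d"
proof (induction k arbitrary: d)
  case 0
  show ?case by (simp add: marginal_def)
next
  case (Suc k)
  have "marginal h (Suc k) (Suc d) \<le> marginal h k d"
    using marginal_step_upper[OF assms(3) Suc] .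
  also have "\<dots> \<le> marginal h (Suc k) d"
    using marginal_step_lower[OF assms(1,2) Suc] .
  finally show ?case .
qed

lemma marginal_increasing_in_time:
  assumes "antimono h" and "\<And>x. 0 \<le> h x" and "mono (\<lambda>x. x + h x)"
  shows "marginal h k d \<le> marginal h (Suc k) d"
  by (intro marginal_step_lower marginal_decreasing assms)

lemma marginal_nonneg:
  assumes "antimono h" and "\<And>x. 0 \<le> h x" and "mono (\<lambda>x. x + h x)"
  shows "0 \<le> marginal h k d"
proof (induction k)
  case 0
  show ?case by (simp add: marginal_def)
next
  case (Suc k)
  then show ?case using marginal_increasing_in_time[OF assms] by (rule order_trans)
qed

lemma solo_revenue_increasing_in_time:
  assumes "\<And>x. 0 \<le> h x"
  shows "solo_revenue h k d \<le> solo_revenue h (Suc k) d"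
  using assms by (cases d) auto

section \<open>The gain from one offer\<close>

definition expected_gain :: "real \<Rightarrow> ('i::finite \<Rightarrow> real) \<Rightarrow> ('i \<Rightarrow> real) \<Rightarrow> real \<Rightarrow> real" where
  "expected_gain c \<theta> p x = c * (\<Sum>i\<in>UNIV. \<theta> i * max 0 (p i - x))"

lemma expected_gain_nonneg:
  assumes "0 \<le> c" and "\<And>i. 0 \<le> \<theta> i"
  shows "0 \<le> expected_gain c \<theta> p x"
  using assms by (auto simp: expected_gain_def intro!: mult_nonneg_nonneg sum_nonneg)

lemma antimono_expected_gain:
  assumes "0 \<le> c" and "\<And>i. 0 \<le> \<theta> i"
  shows "antimono (expected_gain c \<theta> p)"
  unfolding expected_gain_def
  by (intro antimonoI mult_left_mono sum_mono) (auto simp: assms)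

text \<open>
  Each excess \<open>max 0 (p i - x)\<close> falls by at most the increase of \<open>x\<close>, and the weights \<open>c * \<theta> i\<close>
  sum to at most one.
\<close>
lemma mono_add_expected_gain:
  assumes "0 \<le> c" and "c \<le> 1" and "\<And>i. 0 \<le> \<theta> i" and "(\<Sum>i\<in>UNIV. \<theta> i) = 1"
  shows "mono (\<lambda>x. x + expected_gain c \<theta> p x)"
proof (rule monoI)
  fix x y :: real
  assume xy: "x \<le> y"
  have "(\<Sum>i\<in>UNIV. \<theta> i * max 0 (p i - x)) \<le> (\<Sum>i\<in>UNIV. \<theta> i * (max 0 (p i - y) + (y - x)))"
    using xy by (intro sum_mono mult_left_mono) (auto simp: assms(3))
  also have "\<dots> = (\<Sum>i\<in>UNIV. \<theta> i * max 0 (p i - y)) + (y - x)"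
    by (simp add: ring_distribs sum.distrib flip: sum_distrib_right, simp add: assms(4)
        flip: sum_distrib_right right_diff_distrib)
  finally have "expected_gain c \<theta> p x \<le> expected_gain c \<theta> p y + c * (y - x)"
    using assms(1) unfolding expected_gain_def
    by (metis distrib_left mult_left_mono)
  moreover have "c * (y - x) \<le> y - x"
    using assms(2) xy by (simp add: mult_left_le_one_le assms(1))
  ultimately show "x + expected_gain c \<theta> p x \<le> y + expected_gain c \<theta> p y"
    by simp
qed

section \<open>Values do not depend on the sales history\<close>

text \<open>
  A belief conditioned on a null event is unspecified, but still a probability distribution, so the
  equation is unconditional.
\<close>
lemma belief_exp_const [simp]: "belief_exp F n s (\<lambda>C. c) = c"
  by (simp add: belief_exp_def)

text \<open>
  Whether a competitor accepts is immaterial, as the value of seller \<open>n\<close> is the same after a sale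
  by the competitor; only the own branch, weighted \<open>\<pi> n\<close>, adds to the value of waiting.
\<close>
lemma offer_value_history_free:
  assumes "(\<Sum>m\<in>UNIV. \<pi> m) = 1" and u: "\<And>d s. u n d s = f d" and "1 \<le> d"
  shows "offer_value \<pi> F u n d s x = f d + \<pi> n * max 0 (x - (f d - f (d - 1)))"
proof -
  have rest: "(\<Sum>m\<in>UNIV - {n}. \<pi> m) = 1 - \<pi> n"
    using assms(1) by (simp add: sum_diff1)
  have "(\<Sum>m\<in>UNIV - {n}. \<pi> m * belief_exp F n s (\<lambda>C.
          of_bool (accepts F u m (C m - s m) s x) * u n d (s(m := s m + 1))
          + (1 - of_bool (accepts F u m (C m - s m) s x)) * u n d s)) = (1 - \<pi> n) * f d"
    by (simp add: u flip: distrib_right sum_distrib_right rest)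
  moreover have "accepts F u n d s x \<longleftrightarrow> f d - f (d - 1) \<le> x"
    using \<open>1 \<le> d\<close> by (simp add: accepts_def u)
  ultimately show ?thesis
    using assms(1) by (auto simp: offer_value_def u algebra_simps max_def)
qed

lemma seller_value_eq_solo_revenue:
  assumes "(\<Sum>m\<in>UNIV. \<pi> m) = 1" and "(\<Sum>i\<in>UNIV. \<theta> i) = 1" and "\<And>i. 0 \<le> p i" and "t \<le> T"
  shows "seller_value T \<pi> \<theta> p F n t d s =
    solo_revenue (expected_gain (\<pi> n) \<theta> p) (Suc T - t) d"
  using \<open>t \<le> T\<close>
proof (induction t arbitrary: d s rule: inc_induct)
  case base
  show ?case
    by (subst seller_value.simps) (simp add: expected_gain_def assms(3) max_def)
next
  case (step t)
  let ?f = "solo_revenue (expected_gain (\<pi> n) \<theta> p) (T - t)"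
  have horizon: "Suc T - t = Suc (T - t)"
    using step.hyps by simp
  show ?case
  proof (cases "d = 0")
    case True
    then show ?thesis by (subst seller_value.simps) simp
  next
    case False
    then have "seller_value T \<pi> \<theta> p F n t d s =
        (\<Sum>i\<in>UNIV. \<theta> i * (?f d + \<pi> n * max 0 (p i - (?f d - ?f (d - 1)))))"
      using step by (subst seller_value.simps)
        (auto simp: offer_value_history_free[OF assms(1), where f = ?f])
    also have "\<dots> = ?f d + expected_gain (\<pi> n) \<theta> p (?f d - ?f (d - 1))"
      by (simp add: expected_gain_def distrib_left sum.distrib sum_distrib_left mult.left_commute
          assms(2) flip: sum_distrib_right)
    finally show ?thesis using False horizon by simp
  qed
qed

section \<open>Monotonicity and submodularity of the value functions\<close>

theorem theorem2:
  fixes T :: nat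
    and \<pi> :: "'n::finite \<Rightarrow> real"
    and \<theta> p :: "'i::finite \<Rightarrow> real"
    and F :: "'n \<Rightarrow> nat pmf"
    and n :: 'n
    and t d :: nat
    and s :: "'n \<Rightarrow> nat"
  defines "E \<equiv> belief_exp F"
    and "v \<equiv> seller_value T \<pi> \<theta> p F"
  assumes "\<And>m. \<pi> m \<ge> 0" and "(\<Sum>m\<in>UNIV. \<pi> m) = 1"
    and "\<And>i. \<theta> i \<ge> 0" and "(\<Sum>i\<in>UNIV. \<theta> i) = 1"
    and "\<And>i. p i \<ge> 0"
    and "1 \<le> t" and "t \<le> T"
    and "belief_defined F n s"
  shows
    "(1 \<le> d \<longrightarrow>
        E n s (\<lambda>C. v n t d s) \<ge> E n s (\<lambda>C. v n t (d - 1) s)) \<and>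
     (\<forall>i. i \<noteq> n \<and> belief_defined F n (s(i := s i + 1)) \<longrightarrow>
        E n s (\<lambda>C. v n t d s) \<le> E n s (\<lambda>C. v n t d (s(i := s i + 1)))) \<and>
     (t + 1 \<le> T \<longrightarrow>
        E n s (\<lambda>C. v n t d s) \<ge> E n s (\<lambda>C. v n (t + 1) d s)) \<and>
     (1 \<le> d \<longrightarrow>
        E n s (\<lambda>C. v n t d s - v n t (d - 1) (s(n := s n + 1)))
        \<ge> E n s (\<lambda>C. v n t (d + 1) s - v n t d (s(n := s n + 1)))) \<and>
     (1 \<le> d \<and> t + 1 \<le> T \<longrightarrow>
        E n s (\<lambda>C. v n t d s) - E n s (\<lambda>C. v n t (d - 1) (s(n := s n + 1)))
        \<ge> E n s (\<lambda>C. v n (t + 1) d s)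
          - E n s (\<lambda>C. v n (t + 1) (d - 1) (s(n := s n + 1)))) \<and>
     (\<forall>m. 1 \<le> d \<and> m \<noteq> n \<and> 1 \<le> s m \<longrightarrow>
        E n s (\<lambda>C. v n t d s) - E n s (\<lambda>C. v n t (d - 1) (s(n := s n + 1)))
        \<ge> E n s (\<lambda>C. v n t d (s(m := s m - 1)))
          - E n s (\<lambda>C. v n t (d - 1) (s(n := s n + 1, m := s m - 1))))"
proof -
  define h where "h = expected_gain (\<pi> n) \<theta> p"
  define k where "k = T - t"
  have "\<pi> n \<le> (\<Sum>m\<in>UNIV. \<pi> m)"
    using assms(3) by (intro member_le_sum) auto
  then have h: "antimono h" "\<And>x. 0 \<le> h x" "mono (\<lambda>x. x + h x)"
    using assms(3-6) unfolding h_def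
    by (auto intro!: antimono_expected_gain expected_gain_nonneg mono_add_expected_gain)
  have now: "v n t d' s' = solo_revenue h (Suc k) d'" for d' s'
    using seller_value_eq_solo_revenue[where p = p, OF assms(4,6,7,9)] \<open>t \<le> T\<close>
    by (simp add: v_def h_def k_def Suc_diff_le)
  have later: "v n (Suc t) d' s' = solo_revenue h k d'" if "Suc t \<le> T" for d' s'
    using seller_value_eq_solo_revenue[where p = p, OF assms(4,6,7) that]
    by (simp add: v_def h_def k_def)
  have E: "E n s (\<lambda>C. c) = c" for c
    by (simp add: E_def)
  show ?thesis
  proof (cases d)
    case 0
    then show ?thesis by (auto simp: E now later simp del: solo_revenue.simps)
  next
    case (Suc e)
    then show ?thesis
      using marginal_nonneg[OF h, of "Suc k" e] marginal_decreasing[OF h, of "Suc k" e]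
        marginal_increasing_in_time[OF h, of k e] solo_revenue_increasing_in_time[where h = h, OF h(2), of k d]
      by (auto simp: E now later marginal_def simp del: solo_revenue.simps)
  qed
qed

end
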